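(* Let $F:\mathbb{R}^n\to\mathbb{R}$ be differentiable, $\mu_F$-strongly convex and $L_F$-smooth, let $G:\mathbb{R}^m\to\mathbb{R}$ be differentiable, $\mu_G$-strongly convex and $L_G$-smooth (with $\mu_F,L_F,\mu_G,L_G>0$), and let $A\in\mathbb{R}^{m\times n}$. Let $0<r\le 1/L_F$, $0<s\le 1/L_G$, and $\theta=\min\{\sqrt{\mu_F r},\sqrt{\mu_G s}\}$. Let $\{(x_k,y_k)\}_{k\ge 1}$ be the sequence generated by the Nesterov accelerated first-order primal-dual gradient method described in the context, from arbitrary initial points $x_1=x_0\in\mathbb{R}^n$, $y_1=y_0\in\mathbb{R}^m$. Let $(x^*,y^* )$ be the unique saddle point of $\mathcal{L}(x,y)=F(x)+\langle Ax,y\rangle-G(y)$. Then for every $k\ge 1$, $$\mathcal{L}(x_k,y^* )-\mathcal{L}(x^*,y_k)\le \mathcal{E}_1(1-\theta)^{k-1},$$ $$\|x_k-x^*\|^2+\|y_k-y^*\|^2\le \frac{2\mathcal{E}_1}{\min\{\mu_F,\mu_G\}}(1-\theta)^{k-1},$$ where $$\mathcal{E}_1=\mathcal{L}(x_1,y^* )-\mathcal{L}(x^*,y_1)+\frac{\theta^2}{2r}\|x_1-x^*\|^2+\frac{\theta^2}{2s}\|y_1-y^*\|^2 .$$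
   Context: $\langle\cdot,\cdot\rangle$ and $\|\cdot\|$ are the Euclidean inner product and norm. A differentiable function $F:\mathbb{R}^n\to\mathbb{R}$ is $\mu_F$-strongly convex if $F(y)-F(x)-\langle\nabla F(x),y-x\rangle\ge\frac{\mu_F}{2}\|y-x\|^2$ for all $x,y$, and $L_F$-smooth if $\|\nabla F(y)-\nabla F(x)\|\le L_F\|y-x\|$ for all $x,y$; similarly for $G$. The problem is $\min_{x\in\mathbb{R}^n}\max_{y\in\mathbb{R}^m}\mathcal{L}(x,y)=F(x)+\langle Ax,y\rangle-G(y)$. Since $F$ and $G$ are strongly convex, there is a unique $(x^*,y^* )$ with $\mathcal{L}(x^*,y)\le\mathcal{L}(x^*,y^* )\le\mathcal{L}(x,y^* )$ for all $(x,y)\in\mathbb{R}^n\times\mathbb{R}^m$. The parameter satisfies $\theta\in(0,1]$; the convention $0^0=1$ is used. Algorithm (Nesterov accelerated first-order primal-dual gradient method). Input $x_1=x_0\in\mathbb{R}^n$, $y_1=y_0\in\mathbb{R}^m$. Set $\mathcal{B}=\left(\mathbf{I}_n+\frac{rs}{\theta^2}A^TA\right)^{-1}$, where $\mathbf{I}_n$ is the $n\times n$ identity matrix. For $k=1,2,\dots$ compute $$(\bar x_k,\bar y_k)=(x_k,y_k)+\tfrac{1-\theta}{1+\theta}\left[(x_k,y_k)-(x_{k-1},y_{k-1})\right],$$ $$\hat y_k=\bar y_k-s\left(\nabla G(\bar y_k)-\left(1-\tfrac1\theta\right)Ax_k\right),$$ $$x_{k+1}=\mathcal{B}\left(\bar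 x_k-r\left(\nabla F(\bar x_k)+A^T\left(\left(1-\tfrac1\theta\right)y_k+\tfrac1\theta\hat y_k\right)\right)\right),$$ $$y_{k+1}=\bar y_k-s\left(\nabla G(\bar y_k)-A\left(x_k+\tfrac1\theta(x_{k+1}-x_k)\right)\right).$$ *)

theory Defs
  imports "HOL-Analysis.Analysis"
begin

(* Unspecified where F is not differentiable; the predicates strongly_convex and smooth below do
   not include differentiability, which has to be assumed alongside them. *)
definition grad :: "('a::euclidean_space \<Rightarrow> real) \<Rightarrow> 'a \<Rightarrow> 'a" where
  "grad F x = (THE g. GDERIV F x :> g)"

lemma grad_eqI: "GDERIV F x :> g \<Longrightarrow> grad F x = g"
proof -
  assume g: "GDERIV F x :> g"
  have "h = g" if "GDERIV F x :> h" for h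
  proof -
    have "(\<lambda>v. v \<bullet> h) = (\<lambda>v. v \<bullet> g)"
      using that g unfolding gderiv_def by (rule has_derivative_unique)
    then show ?thesis by (metis vector_eq_ldot)
  qed
  with g show "grad F x = g" unfolding grad_def by (rule the_equality)
qed

lemma GDERIV_grad:
  fixes F :: "'a::euclidean_space \<Rightarrow> real"
  assumes "F differentiable (at x)"
  shows "GDERIV F x :> grad F x"
proof -
  from assms obtain D where D: "(F has_derivative D) (at x)"
    by (auto simp: differentiable_def)
  have "D v = v \<bullet> adjoint D 1" for v
    using adjoint_works[OF has_derivative_linear[OF D], of v 1] by simp
  then have "D = (\<lambda>v. v \<bullet> adjoint D 1)" by (rule ext)
  with D have "GDERIV F x :> adjoint D 1" unfolding gderiv_def by simp
  then show ?thesis using grad_eqI by metis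
qed

definition strongly_convex :: "real \<Rightarrow> ('a::euclidean_space \<Rightarrow> real) \<Rightarrow> bool" where
  "strongly_convex \<mu> F \<longleftrightarrow>
     (\<forall>x y. F y - F x - grad F x \<bullet> (y - x) \<ge> \<mu> / 2 * (norm (y - x))\<^sup>2)"

definition smooth :: "real \<Rightarrow> ('a::euclidean_space \<Rightarrow> real) \<Rightarrow> bool" where
  "smooth L F \<longleftrightarrow> (\<forall>x y. norm (grad F y - grad F x) \<le> L * norm (y - x))"

definition saddle_fun ::
  "(real^'n \<Rightarrow> real) \<Rightarrow> (real^'m \<Rightarrow> real) \<Rightarrow> real^'n^'m \<Rightarrow> real^'n \<Rightarrow> real^'m \<Rightarrow> real" where
  "saddle_fun F G A x y = F x + (A *v x) \<bullet> y - G y"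

definition saddle_point :: "('a \<Rightarrow> 'b \<Rightarrow> real) \<Rightarrow> 'a \<Rightarrow> 'b \<Rightarrow> bool" where
  "saddle_point L x' y' \<longleftrightarrow> (\<forall>x y. L x' y \<le> L x' y' \<and> L x' y' \<le> L x y')"

(* Only used for k \<ge> 1, so k - 1 is never truncated. *)
definition extrapolate :: "real \<Rightarrow> (nat \<Rightarrow> 'a::real_vector) \<Rightarrow> nat \<Rightarrow> 'a" where
  "extrapolate \<theta> z k = z k + ((1 - \<theta>) / (1 + \<theta>)) *\<^sub>R (z k - z (k - 1))"

definition preconditioner :: "real^'n^'m \<Rightarrow> real \<Rightarrow> real \<Rightarrow> real \<Rightarrow> real^'n^'n" where
  "preconditioner A r s \<theta> = matrix_inv (mat 1 + (r * s / \<theta>\<^sup>2) *\<^sub>R (transpose A ** A))"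

definition accelerated_primal_dual ::
  "(real^'n \<Rightarrow> real) \<Rightarrow> (real^'m \<Rightarrow> real) \<Rightarrow> real^'n^'m \<Rightarrow> real \<Rightarrow> real \<Rightarrow> real \<Rightarrow>
   (nat \<Rightarrow> real^'n) \<Rightarrow> (nat \<Rightarrow> real^'m) \<Rightarrow> bool" where
  "accelerated_primal_dual F G A r s \<theta> x y \<longleftrightarrow>
     x 1 = x 0 \<and> y 1 = y 0 \<and>
     (\<forall>k\<ge>1.
        let xbar = extrapolate \<theta> x k;
            ybar = extrapolate \<theta> y k;
            yhat = ybar - s *\<^sub>R (grad G ybar - (1 - 1 / \<theta>) *\<^sub>R (A *v x k))
        in x (k + 1) = preconditioner A r s \<theta> *v
             (xbar - r *\<^sub>R (grad F xbar +
               transpose A *v ((1 - 1 / \<theta>) *\<^sub>R y k + (1 / \<theta>) *\<^sub>R yhat))) \<and>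
           y (k + 1) = ybar - s *\<^sub>R
             (grad G ybar - A *v (x k + (1 / \<theta>) *\<^sub>R (x (k + 1) - x k))))"

end

theory Submission
  imports Defs
begin

text \<open>
  The preconditioned update is the explicit form of the implicit scheme
  \<open>x' = p - r (\<nabla>F p + A\<^sup>T v')\<close>, \<open>y' = q - s (\<nabla>G q - A w')\<close>, where \<open>p\<close>, \<open>q\<close> are the
  extrapolated points, \<open>w' = x + (x' - x) / \<theta>\<close> and \<open>v' = y + (y' - y) / \<theta>\<close>. This is one step of Nesterov's method for \<open>F + \<langle>A \<cdot>, y\<^sup>*\<rangle>\<close> and
  one for \<open>G - \<langle>A x\<^sup>*, \<cdot>\<rangle>\<close>, with gradient errors \<open>A\<^sup>T (v' - y\<^sup>*)\<close> and \<open>- A (w' - x\<^sup>*)\<close>. In the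
  estimate for the Lyapunov function (duality gap plus weighted distances of \<open>w\<close> and \<open>v\<close> to the
  saddle point), the contributions of the two errors cancel, so it contracts by \<open>1 - \<theta>\<close>.
\<close>

text \<open>Subtract from \<open>F\<close> on the segment its linear part and the quadratic. The
  derivative at \<open>t\<close> is then
  \<open>(?g - grad F x) \<bullet> d - L * t * (norm d)\<^sup>2\<close>, which Cauchy-Schwarz and
  the Lipschitz bound make nonpositive.\<close>

lemma smooth_upper_bound:
  fixes F :: "'a::euclidean_space \<Rightarrow> real"
  assumes diff: "F differentiable_on UNIV" and sm: "smooth L F"
  shows "F y \<le> F x + grad F x \<bullet> (y - x) + L / 2 * (norm (y - x))\<^sup>2"
proof -
  define d where "d = y - x"
  define f where "f t = F (x + t *\<^sub>R d) - t * (grad F x \<bullet> d) - L / 2 * t\<^sup>2 * (norm d)\<^sup>2" for t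
  have "f 1 \<le> f 0"
  proof (rule DERIV_nonpos_imp_nonincreasing[of 0 1 f])
    fix t :: real
    assume t: "0 \<le> t" "t \<le> 1"
    let ?g = "grad F (x + t *\<^sub>R d)"
    have "GDERIV F (x + t *\<^sub>R d) :> ?g"
      using diff by (intro GDERIV_grad) (simp add: differentiable_on_def)
    then have "(F has_derivative (\<lambda>v. v \<bullet> ?g)) (at (x + t *\<^sub>R d))"
      by (simp add: gderiv_def)
    moreover have "((\<lambda>t. x + t *\<^sub>R d) has_derivative (\<lambda>h. h *\<^sub>R d)) (at t)"
      by (auto intro!: derivative_eq_intros)
    ultimately have "((\<lambda>t. F (x + t *\<^sub>R d)) has_derivative (\<lambda>h. (h *\<^sub>R d) \<bullet> ?g)) (at t)"
      by (rule has_derivative_compose[rotated])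
    moreover have "(\<lambda>h. (h *\<^sub>R d) \<bullet> ?g) = (*) (?g \<bullet> d)"
      by (auto simp: inner_commute)
    ultimately have "((\<lambda>t. F (x + t *\<^sub>R d)) has_real_derivative ?g \<bullet> d) (at t)"
      by (simp add: has_field_derivative_def)
    then have "(f has_real_derivative ?g \<bullet> d - grad F x \<bullet> d - L * t * (norm d)\<^sup>2) (at t)"
      unfolding f_def by (auto intro!: derivative_eq_intros)
    moreover have "?g \<bullet> d - grad F x \<bullet> d \<le> L * t * (norm d)\<^sup>2"
    proof -
      have "?g \<bullet> d - grad F x \<bullet> d = (?g - grad F x) \<bullet> d"
        by (simp add: inner_diff_left)
      also have "\<dots> \<le> norm (?g - grad F x) * norm d"
        by (rule norm_cauchy_schwarz)
      also have "\<dots> \<le> (L * norm (x + t *\<^sub>R d - x)) * norm d"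
        using sm unfolding smooth_def by (intro mult_right_mono norm_ge_zero) blast
      also have "\<dots> = L * t * (norm d)\<^sup>2"
        using t by (simp add: power2_eq_square)
      finally show ?thesis .
    qed
    ultimately show "\<exists>D. (f has_real_derivative D) (at t) \<and> D \<le> 0"
      by (intro exI conjI) auto
  qed simp
  then show ?thesis
    by (simp add: f_def d_def)
qed

text \<open>The quadratic lower and upper bounds are compared between 0 and one unit vector. This
  gives \<theta> \<le> 1 later, through \<mu> r \<le> \<mu> / L \<le> 1.\<close>

lemma strongly_convex_smooth_le:
  fixes F :: "'a::euclidean_space \<Rightarrow> real"
  assumes "F differentiable_on UNIV" "strongly_convex \<mu> F" "smooth L F"
  shows "\<mu> \<le> L"
proof -
  obtain b :: 'a where b: "b \<in> Basis"
    using nonempty_Basis by blast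
  have "F b \<le> F 0 + grad F 0 \<bullet> (b - 0) + L / 2 * (norm (b - 0))\<^sup>2"
    using assms by (intro smooth_upper_bound)
  moreover have "F b - F 0 - grad F 0 \<bullet> (b - 0) \<ge> \<mu> / 2 * (norm (b - 0))\<^sup>2"
    using assms(2) unfolding strongly_convex_def by blast
  ultimately show ?thesis
    using b by simp
qed

lemma grad_eq_uminus_of_minimizer:
  fixes F :: "'a::euclidean_space \<Rightarrow> real"
  assumes "F differentiable (at z)" and min: "\<And>u. F z + c \<bullet> z \<le> F u + c \<bullet> u"
  shows "grad F z = - c"
proof -
  have "(F has_derivative (\<lambda>v. v \<bullet> grad F z)) (at z)"
    using GDERIV_grad[OF assms(1)] by (simp add: gderiv_def)
  then have "((\<lambda>u. F u + c \<bullet> u) has_derivative (\<lambda>v. v \<bullet> grad F z + c \<bullet> v)) (at z)"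
    by (auto intro!: derivative_eq_intros)
  then have "(\<lambda>v. v \<bullet> grad F z + c \<bullet> v) = (\<lambda>v. 0)"
    by (rule differential_zero_maxmin[OF UNIV_I open_UNIV]) (auto simp: min)
  then have "v \<bullet> (grad F z + c) = 0" for v
    by (metis inner_add_right inner_commute)
  then have "grad F z + c = 0"
    using inner_eq_zero_iff by blast
  then show ?thesis
    by (simp add: eq_neg_iff_add_eq_0)
qed

lemma inner_transpose_matrix_vector:
  fixes A :: "real^'n^'m"
  shows "(transpose A *v v) \<bullet> u = v \<bullet> (A *v u)"
  by (simp add: dot_lmul_matrix transpose_matrix_vector)

text \<open>\<open>matrix_inv\<close> is a choice operator, so invertibility has to come first.
  Pairing \<open>M *v u = 0\<close> with \<open>u\<close> gives |u|^2 + c |A u|^2 = 0, hence a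
  trivial kernel.\<close>

lemma preconditioner_solves:
  fixes A :: "real^'n^'m"
  assumes "r > 0" "s > 0" and x: "x = preconditioner A r s \<theta> *v b"
  shows "x + (r * s / \<theta>\<^sup>2) *\<^sub>R (transpose A *v (A *v x)) = b"
proof -
  define c where "c = r * s / \<theta>\<^sup>2"
  define M where "M = mat 1 + c *\<^sub>R (transpose A ** A)"
  have c: "c \<ge> 0"
    using assms by (simp add: c_def)
  have M: "M *v u = u + c *\<^sub>R (transpose A *v (A *v u))" for u
    by (simp add: M_def matrix_vector_mult_add_rdistrib matrix_vector_mul_assoc
        flip: scaleR_matrix_vector_assoc)
  have "u = 0" if "M *v u = 0" for u
  proof -
    have "0 = (M *v u) \<bullet> u"
      by (simp add: that)
    also have "\<dots> = u \<bullet> u + c * ((A *v u) \<bullet> (A *v u))"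
      by (simp only: M inner_add_left inner_scaleR_left inner_transpose_matrix_vector)
    finally have "u \<bullet> u = 0"
      using c by (smt (verit) inner_ge_zero mult_nonneg_nonneg)
    then show "u = 0"
      by simp
  qed
  then have "invertible M"
    by (meson invertible_left_inverse matrix_left_invertible_ker)
  then have "M ** matrix_inv M = mat 1"
    unfolding invertible_def matrix_inv_def by (rule someI2_ex) blast
  then have "M *v x = b"
    by (simp add: x preconditioner_def matrix_vector_mul_assoc flip: M_def c_def)
  then show ?thesis
    by (simp add: M c_def)
qed

text \<open>Here \<open>D\<close> is the slope of the model of \<open>H\<close> at \<open>z\<close>,
  and \<open>g\<close> is the direction actually taken. The error \<open>g - D\<close> stays as an
  inner product with \<open>w' - u\<close>, so that a primal and a dual error can later cancel
  instead of being bounded.\<close>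

lemma nesterov_step:
  fixes H :: "'a::real_inner \<Rightarrow> real" and D g :: 'a
  assumes r: "r > 0" and \<theta>: "0 < \<theta>" "\<theta> \<le> 1" "\<theta>\<^sup>2 \<le> \<mu> * r"
    and upper: "H x' \<le> H z + D \<bullet> (x' - z) + 1 / (2 * r) * (norm (x' - z))\<^sup>2"
    and lower: "\<And>u. H z + D \<bullet> (u - z) + \<mu> / 2 * (norm (u - z))\<^sup>2 \<le> H u"
    and z: "(1 + \<theta>) *\<^sub>R z = x + \<theta> *\<^sub>R w"
    and x': "x' = z - r *\<^sub>R g"
    and w': "w' = x + (1 / \<theta>) *\<^sub>R (x' - x)"
  shows "H x' - H u + \<theta>\<^sup>2 / (2 * r) * (norm (w' - u))\<^sup>2
    \<le> (1 - \<theta>) * (H x - H u + \<theta>\<^sup>2 / (2 * r) * (norm (w - u))\<^sup>2) - \<theta> * ((g - D) \<bullet> (w' - u))"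
proof -
  \<comment> \<open>\<open>w'\<close> is a gradient step from \<open>m\<close>, with step length r /
    \<theta>; this is the content of \<open>rg\<close>. The bound \<open>C \<le> \<mu> / 2\<close>
    restates \<theta>^2 \<le> \<mu> r.\<close>
  define m where "m = (1 - \<theta>) *\<^sub>R w + \<theta> *\<^sub>R z"
  define C where "C = \<theta>\<^sup>2 / (2 * r)"
  have C: "C \<ge> 0" "C \<le> \<mu> / 2"
    using r \<theta> by (simp_all add: C_def field_simps)
  have \<mu>: "\<mu> \<ge> 0"
    using C by linarith
  have x'w': "x' = (1 - \<theta>) *\<^sub>R x + \<theta> *\<^sub>R w'"
    using \<theta> by (simp add: w' algebra_simps)
  have rg: "r *\<^sub>R g = \<theta> *\<^sub>R (m - w')"
  proof -
    have "\<theta> *\<^sub>R (m - w') = (1 - \<theta>) *\<^sub>R (x + \<theta> *\<^sub>R w) + \<theta>\<^sup>2 *\<^sub>R z - x'"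
      unfolding m_def x'w' by (simp add: algebra_simps power2_eq_square)
    also have "\<dots> = z - x'"
      by (simp add: algebra_simps power2_eq_square flip: z)
    finally show ?thesis
      by (simp add: x')
  qed
  have "r * (g \<bullet> (w' - u)) = \<theta> * ((m - w') \<bullet> (w' - u))"
    using arg_cong[OF rg, of "\<lambda>a. a \<bullet> (w' - u)"] by simp
  then have g: "g \<bullet> (w' - u) = \<theta> / r * ((m - w') \<bullet> (w' - u))"
    using r by (simp add: field_simps)
  \<comment> \<open>Since \<open>x'\<close> mixes \<open>x\<close> and \<open>w'\<close>, the lower
    model is used at \<open>x\<close> with weight 1 - \<theta> and at \<open>u\<close> with weight
    \<theta>. The quadratic term is dropped at \<open>x\<close> and kept at
    \<open>u\<close>.\<close>
  have "0 \<le> \<mu> / 2 * (norm (x - z))\<^sup>2"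
    using \<mu> by simp
  then have "(1 - \<theta>) * (H z + D \<bullet> (x - z)) \<le> (1 - \<theta>) * H x"
    using lower[of x] \<theta> by (intro mult_left_mono) linarith+
  moreover have "\<theta> * (H z + D \<bullet> (u - z) + \<mu> / 2 * (norm (u - z))\<^sup>2) \<le> \<theta> * H u"
    using lower[of u] \<theta> by (intro mult_left_mono) auto
  moreover have "D \<bullet> (x' - z) - (1 - \<theta>) * (D \<bullet> (x - z)) - \<theta> * (D \<bullet> (u - z)) = \<theta> * (D \<bullet> (w' - u))"
    unfolding x'w' by (simp add: algebra_simps inner_simps)
  ultimately have "H x' - (1 - \<theta>) * H x - \<theta> * H u
      \<le> \<theta> * (D \<bullet> (w' - u)) + 1 / (2 * r) * (norm (x' - z))\<^sup>2 - \<theta> * (\<mu> / 2 * (norm (u - z))\<^sup>2)"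
    using upper by (simp add: algebra_simps)
  also have "1 / (2 * r) * (norm (x' - z))\<^sup>2 = C * (norm (m - w'))\<^sup>2"
    using \<theta> by (simp add: x' rg C_def power_mult_distrib)
  also have "\<theta> * (D \<bullet> (w' - u)) = \<theta> * (g \<bullet> (w' - u)) - \<theta> * ((g - D) \<bullet> (w' - u))"
    by (simp add: inner_diff_left algebra_simps)
  also have "\<theta> * (g \<bullet> (w' - u)) = C * (2 * ((m - w') \<bullet> (w' - u)))"
    using r by (simp add: g C_def power2_eq_square)
  \<comment> \<open>Three-point identity: its last term absorbs the quadratic loss of the upper
    bound.\<close>
  also have "2 * ((m - w') \<bullet> (w' - u)) = (norm (m - u))\<^sup>2 - (norm (w' - u))\<^sup>2 - (norm (m - w'))\<^sup>2"
    by (simp add: power2_norm_eq_inner inner_simps inner_commute algebra_simps)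
  finally have main: "H x' - (1 - \<theta>) * H x - \<theta> * H u
      \<le> C * (norm (m - u))\<^sup>2 - C * (norm (w' - u))\<^sup>2 - \<theta> * ((g - D) \<bullet> (w' - u))
        - \<theta> * (\<mu> / 2 * (norm (u - z))\<^sup>2)"
    by (simp add: algebra_simps)
  have "(norm (m - u))\<^sup>2 = (1 - \<theta>) * (norm (w - u))\<^sup>2 + \<theta> * (norm (z - u))\<^sup>2
      - \<theta> * (1 - \<theta>) * (norm (w - z))\<^sup>2"
    by (simp add: m_def power2_norm_eq_inner inner_simps inner_commute algebra_simps)
  also have "\<dots> \<le> (1 - \<theta>) * (norm (w - u))\<^sup>2 + \<theta> * (norm (z - u))\<^sup>2"
    using \<theta> by simp
  finally have "C * (norm (m - u))\<^sup>2
      \<le> C * ((1 - \<theta>) * (norm (w - u))\<^sup>2 + \<theta> * (norm (z - u))\<^sup>2)"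
    using C by (intro mult_left_mono)
  \<comment> \<open>The strong convexity kept at \<open>u\<close> pays for the share of
    \<open>z\<close> in \<open>m\<close>.\<close>
  moreover have "\<theta> * (C * (norm (u - z))\<^sup>2) \<le> \<theta> * (\<mu> / 2 * (norm (u - z))\<^sup>2)"
    using C \<theta> by (intro mult_left_mono mult_right_mono) auto
  ultimately show ?thesis
    using main unfolding C_def[symmetric] by (simp add: algebra_simps norm_minus_commute)
qed

text \<open>For \<theta> \<noteq> 0 this is the point \<open>p\<close> with \<open>z k = (1 -
  \<theta>) *\<^sub>R z (k - 1) + \<theta> *\<^sub>R p\<close>. The index is chosen so that step
  \<open>k\<close> produces \<open>lookahead \<theta> z (Suc k)\<close>.\<close>

definition lookahead :: "real \<Rightarrow> (nat \<Rightarrow> 'a::real_vector) \<Rightarrow> nat \<Rightarrow> 'a" where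
  "lookahead \<theta> z k = z (k - 1) + (1 / \<theta>) *\<^sub>R (z k - z (k - 1))"

text \<open>The momentum coefficient is the one that puts the extrapolated point between
  \<open>z k\<close> and the lookahead point with weights 1 : \<theta>.\<close>

lemma extrapolate_eq:
  assumes "\<theta> > 0"
  shows "(1 + \<theta>) *\<^sub>R extrapolate \<theta> z k = z k + \<theta> *\<^sub>R lookahead \<theta> z k"
proof -
  have "(1 + \<theta>) *\<^sub>R extrapolate \<theta> z k = (1 + \<theta>) *\<^sub>R z k + (1 - \<theta>) *\<^sub>R (z k - z (k - 1))"
    using assms by (simp add: extrapolate_def scaleR_add_right)
  also have "\<dots> = z k + \<theta> *\<^sub>R lookahead \<theta> z k"
    using assms by (simp add: lookahead_def algebra_simps)
  finally show ?thesis .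
qed

text \<open>A linear tilt changes neither curvature constant, and \<open>grad F zb\<close> drops out
  of the error, leaving \<open>e - c\<close>. Here \<open>c\<close> is the coupling term at the
  saddle point and \<open>e\<close> the one used by the iteration.\<close>

lemma nesterov_step_tilted:
  fixes F :: "'a::euclidean_space \<Rightarrow> real" and z :: "nat \<Rightarrow> 'a" and c e :: 'a
  assumes F: "F differentiable_on UNIV" "strongly_convex \<mu> F" "smooth L F"
    and L: "L > 0" and r: "0 < r" "r \<le> 1 / L"
    and \<theta>: "0 < \<theta>" "\<theta> \<le> 1" "\<theta>\<^sup>2 \<le> \<mu> * r"
    and step: "z (Suc k) = extrapolate \<theta> z k - r *\<^sub>R (grad F (extrapolate \<theta> z k) + e)"
  defines "H \<equiv> \<lambda>u. F u + c \<bullet> u"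
  defines "w \<equiv> lookahead \<theta> z"
  shows "H (z (Suc k)) - H u + \<theta>\<^sup>2 / (2 * r) * (norm (w (Suc k) - u))\<^sup>2
    \<le> (1 - \<theta>) * (H (z k) - H u + \<theta>\<^sup>2 / (2 * r) * (norm (w k - u))\<^sup>2)
      - \<theta> * ((e - c) \<bullet> (w (Suc k) - u))"
proof -
  define zb where "zb = extrapolate \<theta> z k"
  have "H (z (Suc k)) - H u + \<theta>\<^sup>2 / (2 * r) * (norm (w (Suc k) - u))\<^sup>2
    \<le> (1 - \<theta>) * (H (z k) - H u + \<theta>\<^sup>2 / (2 * r) * (norm (w k - u))\<^sup>2)
      - \<theta> * ((grad F zb + e - (grad F zb + c)) \<bullet> (w (Suc k) - u))"
  proof (rule nesterov_step[OF r(1) \<theta>])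
    let ?d = "z (Suc k) - zb"
    \<comment> \<open>The step size bound r \<le> 1 / L enters here.\<close>
    have "L / 2 * (norm ?d)\<^sup>2 \<le> 1 / (2 * r) * (norm ?d)\<^sup>2"
      using L r by (intro mult_right_mono) (auto simp: field_simps)
    then show "H (z (Suc k)) \<le> H zb + (grad F zb + c) \<bullet> ?d + 1 / (2 * r) * (norm ?d)\<^sup>2"
      using smooth_upper_bound[OF F(1,3), of "z (Suc k)" zb]
      by (simp add: H_def inner_add_left inner_diff_right)
    show "H zb + (grad F zb + c) \<bullet> (v - zb) + \<mu> / 2 * (norm (v - zb))\<^sup>2 \<le> H v" for v
    proof -
      have "F v - F zb - grad F zb \<bullet> (v - zb) \<ge> \<mu> / 2 * (norm (v - zb))\<^sup>2"
        using F(2) unfolding strongly_convex_def by blast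
      then show ?thesis
        by (simp add: H_def inner_add_left inner_diff_right)
    qed
    show "(1 + \<theta>) *\<^sub>R zb = z k + \<theta> *\<^sub>R w k"
      using \<theta>(1) unfolding zb_def w_def by (rule extrapolate_eq)
    show "z (Suc k) = zb - r *\<^sub>R (grad F zb + e)"
      using step by (simp add: zb_def)
    show "w (Suc k) = z k + (1 / \<theta>) *\<^sub>R (z (Suc k) - z k)"
      by (simp add: w_def lookahead_def)
  qed
  then show ?thesis
    by simp
qed

text \<open>The explicit update of \<open>x\<close> uses \<open>yhat\<close>, which omits the
  contribution of the new \<open>x\<close> to the new \<open>y\<close>. That contribution is linear
  in the new \<open>x\<close>, and inverting the preconditioner restores it.\<close>

lemma accelerated_primal_dual_implicit:
  fixes A :: "real^'n^'m"
  assumes alg: "accelerated_primal_dual F G A r s \<theta> x y"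
    and pos: "r > 0" "s > 0" and k: "k \<ge> 1"
  shows "x (Suc k) = extrapolate \<theta> x k
      - r *\<^sub>R (grad F (extrapolate \<theta> x k) + transpose A *v lookahead \<theta> y (Suc k))"
    and "y (Suc k) = extrapolate \<theta> y k
      - s *\<^sub>R (grad G (extrapolate \<theta> y k) + - (A *v lookahead \<theta> x (Suc k)))"
proof -
  define xb where "xb = extrapolate \<theta> x k"
  define yb where "yb = extrapolate \<theta> y k"
  define yh where "yh = yb - s *\<^sub>R (grad G yb - (1 - 1 / \<theta>) *\<^sub>R (A *v x k))"
  define a where "a = (1 - 1 / \<theta>) *\<^sub>R y k + (1 / \<theta>) *\<^sub>R yh"
  have x': "x (Suc k) = preconditioner A r s \<theta> *v (xb - r *\<^sub>R (grad F xb + transpose A *v a))"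
    and y': "y (Suc k) = yb - s *\<^sub>R (grad G yb - A *v (x k + (1 / \<theta>) *\<^sub>R (x (Suc k) - x k)))"
    using alg k
    by (auto simp: accelerated_primal_dual_def Let_def xb_def yb_def yh_def a_def)
  then show "y (Suc k) = yb - s *\<^sub>R (grad G yb + - (A *v lookahead \<theta> x (Suc k)))"
    by (simp add: lookahead_def)
  have "y (Suc k) = yh + (s / \<theta>) *\<^sub>R (A *v x (Suc k))"
    unfolding y' yh_def
    by (simp add: matrix_vector_right_distrib matrix_vector_mult_diff_distrib
        matrix_vector_mult_scaleR algebra_simps)
  \<comment> \<open>One factor 1 / \<theta> comes from the dual update and one from the lookahead,
    whence \<theta>^2 in the preconditioner.\<close>
  then have v: "lookahead \<theta> y (Suc k) = a + (s / \<theta>\<^sup>2) *\<^sub>R (A *v x (Suc k))"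
    by (simp add: lookahead_def a_def algebra_simps power2_eq_square)
  have "x (Suc k) + (r * s / \<theta>\<^sup>2) *\<^sub>R (transpose A *v (A *v x (Suc k)))
      = xb - r *\<^sub>R (grad F xb + transpose A *v a)"
    using pos x' by (rule preconditioner_solves)
  then show "x (Suc k) = xb - r *\<^sub>R (grad F xb + transpose A *v lookahead \<theta> y (Suc k))"
    unfolding v
    by (simp add: matrix_vector_right_distrib matrix_vector_mult_scaleR algebra_simps)
qed

theorem theorem1:
  fixes F :: "real^'n \<Rightarrow> real" and G :: "real^'m \<Rightarrow> real" and A :: "real^'n^'m"
    and \<mu>\<^sub>F L\<^sub>F \<mu>\<^sub>G L\<^sub>G r s \<theta> E1 :: real
    and x :: "nat \<Rightarrow> real^'n" and y :: "nat \<Rightarrow> real^'m"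
    and xs :: "real^'n" and ys :: "real^'m"
  assumes "\<mu>\<^sub>F > 0" and "L\<^sub>F > 0" and "\<mu>\<^sub>G > 0" and "L\<^sub>G > 0"
    and "F differentiable_on UNIV" and "strongly_convex \<mu>\<^sub>F F" and "smooth L\<^sub>F F"
    and "G differentiable_on UNIV" and "strongly_convex \<mu>\<^sub>G G" and "smooth L\<^sub>G G"
    and "0 < r" and "r \<le> 1 / L\<^sub>F"
    and "0 < s" and "s \<le> 1 / L\<^sub>G"
    and "\<theta> = min (sqrt (\<mu>\<^sub>F * r)) (sqrt (\<mu>\<^sub>G * s))"
    and "accelerated_primal_dual F G A r s \<theta> x y"
    and "saddle_point (saddle_fun F G A) xs ys"
    and "E1 = saddle_fun F G A (x 1) ys - saddle_fun F G A xs (y 1)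
           + \<theta>\<^sup>2 / (2 * r) * (norm (x 1 - xs))\<^sup>2 + \<theta>\<^sup>2 / (2 * s) * (norm (y 1 - ys))\<^sup>2"
  shows "\<forall>k\<ge>1.
      saddle_fun F G A (x k) ys - saddle_fun F G A xs (y k) \<le> E1 * (1 - \<theta>) ^ (k - 1) \<and>
      (norm (x k - xs))\<^sup>2 + (norm (y k - ys))\<^sup>2
        \<le> 2 * E1 / min \<mu>\<^sub>F \<mu>\<^sub>G * (1 - \<theta>) ^ (k - 1)"
proof -
  note pos = assms(1-4) and F = assms(5-7) and G = assms(8-10) and r = assms(11,12)
    and s = assms(13,14) and \<theta>_def = assms(15) and alg = assms(16) and saddle = assms(17)
    and E1 = assms(18)
  have \<theta>_pos: "\<theta> > 0"
    using pos r s by (simp add: \<theta>_def)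
  have "\<theta>\<^sup>2 \<le> (sqrt (\<mu>\<^sub>F * r))\<^sup>2" "\<theta>\<^sup>2 \<le> (sqrt (\<mu>\<^sub>G * s))\<^sup>2"
    using \<theta>_pos \<theta>_def by (intro power_mono; simp)+
  then have \<theta>_sq: "\<theta>\<^sup>2 \<le> \<mu>\<^sub>F * r" "\<theta>\<^sup>2 \<le> \<mu>\<^sub>G * s"
    using pos r s by auto
  have "\<mu>\<^sub>F * r \<le> L\<^sub>F * (1 / L\<^sub>F)"
    using pos r strongly_convex_smooth_le[OF F] by (intro mult_mono) auto
  then have "\<theta>\<^sup>2 \<le> 1"
    using \<theta>_sq pos by simp
  then have \<theta>_le: "\<theta> \<le> 1"
    using \<theta>_pos by (simp add: power_le_one_iff)
  define c where "c = transpose A *v ys"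
  define d where "d = - (A *v xs)"
  \<comment> \<open>With the other argument frozen at the saddle point, the duality gap separates
    into a function of \<open>u\<close> and one of \<open>v\<close>. The constants
    \<open>c \<bullet> xs\<close> and \<open>d \<bullet> ys\<close> are opposite numbers.\<close>
  define gap where "gap u v = (F u + c \<bullet> u - (F xs + c \<bullet> xs)) + (G v + d \<bullet> v - (G ys + d \<bullet> ys))"
    for u v
  have c: "c \<bullet> u = ys \<bullet> (A *v u)" for u
    unfolding c_def by (rule inner_transpose_matrix_vector)
  have gap: "saddle_fun F G A u ys - saddle_fun F G A xs v = gap u v" for u v
    by (simp add: saddle_fun_def gap_def c d_def inner_commute)
  define w where "w = lookahead \<theta> x"
  define v where "v = lookahead \<theta> y"
  define E where "E k = gap (x k) (y k) + \<theta>\<^sup>2 / (2 * r) * (norm (w k - xs))\<^sup>2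
    + \<theta>\<^sup>2 / (2 * s) * (norm (v k - ys))\<^sup>2" for k
  have contract: "E (Suc k) \<le> (1 - \<theta>) * E k" if k: "k \<ge> 1" for k
  proof -
    note impl = accelerated_primal_dual_implicit[OF alg r(1) s(1) k]
    \<comment> \<open>By adjointness the two terms are the same bilinear expression in
      \<open>w (Suc k) - xs\<close> and \<open>v (Suc k) - ys\<close>, with opposite signs.\<close>
    have cancel: "(transpose A *v v (Suc k) - c) \<bullet> (w (Suc k) - xs)
        + (- (A *v w (Suc k)) - d) \<bullet> (v (Suc k) - ys) = 0"
      by (simp only: inner_diff_left inner_diff_right inner_transpose_matrix_vector c d_def)
        (simp add: inner_diff_left inner_diff_right inner_commute)
    show ?thesis
      using nesterov_step_tilted[OF F pos(2) r \<theta>_pos \<theta>_le \<theta>_sq(1) impl(1), of c xs]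
        nesterov_step_tilted[OF G pos(4) s \<theta>_pos \<theta>_le \<theta>_sq(2) impl(2), of d ys]
        arg_cong[OF cancel, of "(*) \<theta>"]
      unfolding E_def gap_def w_def v_def by (simp add: algebra_simps)
  qed
  \<comment> \<open>Equal starting points make \<open>w 1 = x 1\<close> and
    \<open>v 1 = y 1\<close>, so the initial energy involves only the initial iterates.\<close>
  have "x 1 = x 0" "y 1 = y 0"
    using alg by (simp_all add: accelerated_primal_dual_def)
  then have E_1: "E 1 = E1"
    by (simp add: E_def E1 gap w_def v_def lookahead_def)
  have E_le: "E k \<le> E1 * (1 - \<theta>) ^ (k - 1)" if "k \<ge> 1" for k
    using that
  proof (induction k rule: dec_induct)
    case base
    show ?case
      using E_1 by simp
  next
    case (step k)
    have "E (Suc k) \<le> (1 - \<theta>) * E k"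
      using step.hyps(1) by (rule contract)
    also have "\<dots> \<le> (1 - \<theta>) * (E1 * (1 - \<theta>) ^ (k - 1))"
      using step.IH \<theta>_le by (intro mult_left_mono) auto
    also have "\<dots> = E1 * (1 - \<theta>) ^ (Suc k - 1)"
      using step.hyps by (cases k) auto
    finally show ?case .
  qed
  have gap_le: "gap (x k) (y k) \<le> E k" for k
  proof -
    have "\<theta>\<^sup>2 / (2 * r) * (norm (w k - xs))\<^sup>2 \<ge> 0" "\<theta>\<^sup>2 / (2 * s) * (norm (v k - ys))\<^sup>2 \<ge> 0"
      using r s by auto
    then show ?thesis
      by (simp add: E_def)
  qed
  \<comment> \<open>As \<open>gap\<close> separates, these say that \<open>xs\<close> minimises the
    tilted \<open>F\<close> and \<open>ys\<close> the tilted \<open>G\<close>.\<close>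
  have opt: "gap xs ys \<le> gap u ys" "gap xs ys \<le> gap xs u'" for u u'
    using saddle unfolding gap[symmetric] saddle_point_def by auto
  have "grad F xs = - c"
    using F(1) opt(1) by (intro grad_eq_uminus_of_minimizer)
      (auto simp: differentiable_on_def gap_def)
  moreover have "grad G ys = - d"
    using G(1) opt(2) by (intro grad_eq_uminus_of_minimizer)
      (auto simp: differentiable_on_def gap_def)
  moreover have "\<mu>\<^sub>F / 2 * (norm (a - xs))\<^sup>2 \<le> F a - F xs - grad F xs \<bullet> (a - xs)"
    "\<mu>\<^sub>G / 2 * (norm (b - ys))\<^sup>2 \<le> G b - G ys - grad G ys \<bullet> (b - ys)" for a b
    using F(2) G(2) unfolding strongly_convex_def by auto
  \<comment> \<open>The stationarity conditions turn the gap into a sum of two Bregman divergences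
    based at the saddle point, which strong convexity bounds from below.\<close>
  ultimately have gap_ge: "\<mu>\<^sub>F / 2 * (norm (a - xs))\<^sup>2 + \<mu>\<^sub>G / 2 * (norm (b - ys))\<^sup>2 \<le> gap a b" for a b
    unfolding gap_def by (smt (verit) inner_minus_left inner_diff_right)
  define \<mu> where "\<mu> = min \<mu>\<^sub>F \<mu>\<^sub>G"
  have \<mu>: "\<mu> > 0" "\<mu> \<le> \<mu>\<^sub>F" "\<mu> \<le> \<mu>\<^sub>G"
    using pos by (auto simp: \<mu>_def)
  show ?thesis
    unfolding gap \<mu>_def[symmetric]
  proof (intro allI impI conjI)
    fix k :: nat
    assume k: "k \<ge> 1"
    show bound: "gap (x k) (y k) \<le> E1 * (1 - \<theta>) ^ (k - 1)"
      using gap_le[of k] E_le[OF k] by linarith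
    have "\<mu> * (norm (x k - xs))\<^sup>2 \<le> \<mu>\<^sub>F * (norm (x k - xs))\<^sup>2"
      "\<mu> * (norm (y k - ys))\<^sup>2 \<le> \<mu>\<^sub>G * (norm (y k - ys))\<^sup>2"
      using \<mu> by (auto intro: mult_right_mono)
    then have "\<mu> * ((norm (x k - xs))\<^sup>2 + (norm (y k - ys))\<^sup>2) \<le> 2 * gap (x k) (y k)"
      using gap_ge[of "x k" "y k"] by (simp add: distrib_left)
    also have "\<dots> \<le> 2 * (E1 * (1 - \<theta>) ^ (k - 1))"
      using bound by simp
    finally show "(norm (x k - xs))\<^sup>2 + (norm (y k - ys))\<^sup>2 \<le> 2 * E1 / \<mu> * (1 - \<theta>) ^ (k - 1)"
      using \<mu>(1) by (simp add: field_simps)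
  qed
qed

end
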